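(* Let $G=(\mathcal{V},\mathcal{E})$ be a finite directed graph with edge costs, in which each vertex $v$ supports a set $\Phi_v$ of network functions, and let $(v_s,\phi_1,\dots,\phi_r,v_d)$ be an SFC constraint with source $v_s\in\mathcal{V}$ and destination $v_d\in\mathcal{V}$. Let $\bar G=(\bar{\mathcal{V}},\bar{\mathcal{E}})$ be the graph constructed from $G$ and this SFC constraint as described in the context (before or after the pruning step), and let $t$ be the largest index in $\{0,\dots,r\}$ with $\{\phi_1,\dots,\phi_t\}\subseteq\Phi_{v_s}$. If $\bar p$ is a shortest (minimum-cost) path from $v_s^t$ to $v_d^r$ in $\bar G$, then the path $p$ in $G$ obtained from $\bar p$ by replacing each virtual vertex $v_k^i$ by $v_k$ is a shortest path among all paths from $v_s$ to $v_d$ in $G$ that satisfy the SFC constraint.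
   Context: Paths: a path in a directed graph is a sequence of vertices $(u_0,u_1,\dots,u_n)$, $n\ge 0$, in which each $(u_{m},u_{m+1})$ is an edge; vertices and edges may be repeated (a packet may need to visit the same vertex more than once). The cost of a path is the sum of the costs of its edges, counted with multiplicity. "Shortest" means of minimum cost. SFC constraint: a path $(u_0,\dots,u_n)$ in $G$ satisfies the (partial) service function chain $(\phi_1,\dots,\phi_i)$ if there are indices $0\le a_1\le a_2\le\dots\le a_i\le n$ with $\phi_m\in\Phi_{u_{a_m}}$ for $m=1,\dots,i$ (several functions may be applied at the same vertex, and functions at the first and last vertices of the path may be used). A path from $v_s$ to $v_d$ satisfies the SFC constraint $(v_s,\phi_1,\dots,\phi_r,v_d)$ if it satisfies the chain $(\phi_1,\dots,\phi_r)$. Construction of $\bar G$: for each $v_k\in\mathcal{V}$, create $r+1$ virtual vertices $v_k^0,\dots,v_k^r$ in $\bar{\mathcal{V}}$. For each edge $(v_l,v_k)\in\mathcal{E}$ and each $i\in\{0,\dots,r\}$, let $$j^*=\max\{j : i\le j\le r,\ \{\phi_{i+1},\dots,\phi_j\}\subseteq\Phi_{v_k}\}$$ (the set $\{\phi_{i+1},\dots,\phi_j\}$ being empty when $j=i$), and add to $\bar{\mathcal{E}}$ the edge $(v_l^i,v_k^{j^*})$, with the same cost as $(v_l,v_k)$. There are no other edges. Pruning step: while there is a vertex of the current graph, other than the source $v_s^t$ and the destination $v_d^r$, that has no incoming edge or has no outgoing edge, remove that vertex and all edges incident to it. *)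

theory Defs
  imports Complex_Main "Graph_Theory.Graph_Theory"
begin

text \<open>
  Paths are vertex sequences with repetitions allowed, i.e. \<open>vwalk\<close> (not \<open>vpath\<close>, which requires
  distinct vertices). The one-element sequence is the path with no edges.
\<close>

definition walks_between :: "('a, 'b) pre_digraph \<Rightarrow> 'a \<Rightarrow> 'a \<Rightarrow> 'a vwalk set" where
  "walks_between H u v = {p. vwalk p H \<and> hd p = u \<and> last p = v}"

definition vwalk_cost :: "('a \<times> 'a) weight_fun \<Rightarrow> 'a vwalk \<Rightarrow> real" where
  "vwalk_cost c p = sum_list (map c (vwalk_arcs p))"

definition shortest_in :: "('a \<times> 'a) weight_fun \<Rightarrow> 'a vwalk set \<Rightarrow> 'a vwalk \<Rightarrow> bool" where
  "shortest_in c P p \<longleftrightarrow> p \<in> P \<and> (\<forall>q\<in>P. vwalk_cost c p \<le> vwalk_cost c q)"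

text \<open>
  The chain \<open>(\<phi>\<^sub>1, \<dots>, \<phi>\<^sub>i)\<close> is given by \<open>\<phi> :: nat \<Rightarrow> 'f\<close> restricted to the indices \<open>{1..i}\<close>, and
  \<open>\<Phi> v\<close> is the set of functions supported at \<open>v\<close>. The witness \<open>a\<close> need only be weakly increasing, so
  several functions may be applied at one vertex of the path.
\<close>

definition satisfies_chain ::
    "('v \<Rightarrow> 'f set) \<Rightarrow> (nat \<Rightarrow> 'f) \<Rightarrow> nat \<Rightarrow> 'v vwalk \<Rightarrow> bool" where
  "satisfies_chain \<Phi> \<phi> i p \<longleftrightarrow>
    (\<exists>a :: nat \<Rightarrow> nat. mono_on {1..i} a \<and> (\<forall>m\<in>{1..i}. a m < length p \<and> \<phi> m \<in> \<Phi> (p ! a m)))"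

definition sfc_walks ::
    "('v, 'b) pre_digraph \<Rightarrow> ('v \<Rightarrow> 'f set) \<Rightarrow> (nat \<Rightarrow> 'f) \<Rightarrow> nat \<Rightarrow> 'v \<Rightarrow> 'v \<Rightarrow> 'v vwalk set" where
  "sfc_walks G \<Phi> \<phi> r s d = {p \<in> walks_between G s d. satisfies_chain \<Phi> \<phi> r p}"

text \<open>The virtual vertex \<open>v\<^sub>k\<^sup>i\<close> is the pair \<open>(v\<^sub>k, i)\<close>; \<open>jump \<phi> r (\<Phi> v\<^sub>k) i\<close> is \<open>j\<^sup>*\<close>.\<close>

definition jump :: "(nat \<Rightarrow> 'f) \<Rightarrow> nat \<Rightarrow> 'f set \<Rightarrow> nat \<Rightarrow> nat" where
  "jump \<phi> r F i = Max {j. i \<le> j \<and> j \<le> r \<and> \<phi> ` {i+1..j} \<subseteq> F}"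

definition virtual_graph ::
    "'v pair_pre_digraph \<Rightarrow> ('v \<Rightarrow> 'f set) \<Rightarrow> (nat \<Rightarrow> 'f) \<Rightarrow> nat \<Rightarrow> ('v \<times> nat) pair_pre_digraph" where
  "virtual_graph G \<Phi> \<phi> r =
    \<lparr> pverts = pverts G \<times> {0..r},
      parcs = {((l, i), (k, jump \<phi> r (\<Phi> k) i)) | l k i. (l, k) \<in> parcs G \<and> i \<in> {0..r}} \<rparr>"

definition virtual_cost :: "('v \<times> 'v) weight_fun \<Rightarrow> (('v \<times> nat) \<times> ('v \<times> nat)) weight_fun" where
  "virtual_cost c = (\<lambda>((l, i), (k, j)). c (l, k))"

inductive prune_step :: "'a \<Rightarrow> 'a \<Rightarrow> ('a, 'b) pre_digraph \<Rightarrow> ('a, 'b) pre_digraph \<Rightarrow> bool"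
  for s d :: 'a where
  "\<lbrakk>x \<in> verts H; x \<noteq> s; x \<noteq> d; in_arcs H x = {} \<or> out_arcs H x = {}\<rbrakk>
    \<Longrightarrow> prune_step s d H (pre_digraph.del_vert H x)"

text \<open>\<open>H'\<close> is a result of removing vertices of \<open>H\<close>, in any order, until no removal is possible.\<close>

definition pruned :: "'a \<Rightarrow> 'a \<Rightarrow> ('a, 'b) pre_digraph \<Rightarrow> ('a, 'b) pre_digraph \<Rightarrow> bool" where
  "pruned s d H H' \<longleftrightarrow> (prune_step s d)\<^sup>*\<^sup>* H H' \<and> (\<nexists>H''. prune_step s d H' H'')"

lemma jump_set_finite: "finite {j::nat. i \<le> j \<and> j \<le> r \<and> \<phi> ` {i+1..j} \<subseteq> F}"
  by (rule finite_subset[of _ "{..r}"]) auto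

lemma jump_set_nonempty:
  "(i::nat) \<le> r \<Longrightarrow> {j. i \<le> j \<and> j \<le> r \<and> \<phi> ` {i+1..j} \<subseteq> F} \<noteq> {}"
  by (auto intro!: exI[of _ i])

lemma jump_bounds:
  assumes "i \<le> r"
  shows "i \<le> jump \<phi> r F i" "jump \<phi> r F i \<le> r" "\<phi> ` {i+1..jump \<phi> r F i} \<subseteq> F"
  using Max_in[OF jump_set_finite jump_set_nonempty[OF assms], of \<phi> F]
  unfolding jump_def by blast+

lemma pair_fin_digraph_virtual_graph:
  assumes "pair_fin_digraph G"
  shows "pair_fin_digraph (virtual_graph G \<Phi> \<phi> r)"
proof -
  interpret pair_fin_digraph G by fact
  let ?V = "virtual_graph G \<Phi> \<phi> r"
  have wf: "parcs ?V \<subseteq> pverts ?V \<times> pverts ?V"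
  proof
    fix e assume "e \<in> parcs ?V"
    then obtain l k i where "e = ((l, i), (k, jump \<phi> r (\<Phi> k) i))" "(l, k) \<in> parcs G" "i \<le> r"
      unfolding virtual_graph_def by auto
    moreover from this have "l \<in> pverts G" "k \<in> pverts G"
      by (blast dest: in_arcsD1 in_arcsD2)+
    ultimately show "e \<in> pverts ?V \<times> pverts ?V"
      using jump_bounds(2)[of i r \<phi> "\<Phi> k"] by (simp add: virtual_graph_def)
  qed
  have fin: "finite (pverts ?V)"
    using pair_finite_verts by (simp add: virtual_graph_def)
  show ?thesis
  proof
    show "finite (parcs ?V)" using finite_subset[OF wf] fin by blast
  next
    fix e assume "e \<in> parcs ?V"
    then have "e \<in> pverts ?V \<times> pverts ?V" using wf by (rule subsetD[rotated])
    then show "fst e \<in> pverts ?V" "snd e \<in> pverts ?V" by (simp_all only: mem_Times_iff)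
  qed (fact fin)
qed

lemma pruned_exists:
  assumes "finite (verts H)"
  shows "\<exists>H'. pruned s d H H'"
  using assms
proof (induction "card (verts H)" arbitrary: H rule: less_induct)
  case less
  show ?case
  proof (cases "\<exists>H''. prune_step s d H H''")
    case True
    then obtain H'' where step: "prune_step s d H H''" by blast
    then obtain x where "x \<in> verts H" "verts H'' = verts H - {x}"
      by cases (auto simp: pre_digraph.verts_del_vert)
    then have "card (verts H'') < card (verts H)" "finite (verts H'')"
      using card_Diff1_less[OF less.prems] less.prems by simp_all
    from less.hyps[OF this] obtain H' where "pruned s d H'' H'" by blast
    with step have "pruned s d H H'"
      unfolding pruned_def by (blast intro: converse_rtranclp_into_rtranclp)
    then show ?thesis ..
  next
    case False
    then have "pruned s d H H" unfolding pruned_def by blast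
    then show ?thesis ..
  qed
qed

end

theory Submission
  imports Defs
begin

text \<open>
  Applying every function as early as possible is optimal, because a greedy application of the chain
  never lags behind any admissible one. The level of a virtual vertex records the progress of this
  greedy strategy, so each walk in \<open>G\<close> has exactly one lift starting at \<open>(v\<^sub>s, t)\<close>; the lift
  has the same cost, and it ends at level \<open>r\<close> iff the walk satisfies the chain. Hence the projection
  is a cost-preserving bijection onto the walks that satisfy the constraint. Pruning
  only removes vertices that lie on no walk from source to destination.
\<close>

lemma jump_greatest:
  assumes "i \<le> j" "j \<le> r" "\<phi> ` {i+1..j} \<subseteq> F"
  shows "j \<le> jump \<phi> r F i"
  unfolding jump_def using assms by (intro Max_ge[OF jump_set_finite]) blast

definition greedy_level :: "('v \<Rightarrow> 'f set) \<Rightarrow> (nat \<Rightarrow> 'f) \<Rightarrow> nat \<Rightarrow> nat \<Rightarrow> 'v list \<Rightarrow> nat" where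
  "greedy_level \<Phi> \<phi> r = foldl (\<lambda>i v. jump \<phi> r (\<Phi> v) i)"

text \<open>Generalises \<open>satisfies_chain\<close> to the state in which the first
  \<open>i\<close> functions are already applied and \<open>q\<close> is still to be visited. An
  induction along the walk needs this, since \<open>i\<close> grows as vertices are
  consumed.\<close>

definition chain_from :: "('v \<Rightarrow> 'f set) \<Rightarrow> (nat \<Rightarrow> 'f) \<Rightarrow> nat \<Rightarrow> nat \<Rightarrow> 'v list \<Rightarrow> bool" where
  "chain_from \<Phi> \<phi> r i q \<longleftrightarrow>
    (\<exists>a :: nat \<Rightarrow> nat. mono_on {i+1..r} a \<and> (\<forall>m\<in>{i+1..r}. a m < length q \<and> \<phi> m \<in> \<Phi> (q ! a m)))"

lemma satisfies_chain_iff_chain_from: "satisfies_chain \<Phi> \<phi> r q \<longleftrightarrow> chain_from \<Phi> \<phi> r 0 q"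
  by (simp add: satisfies_chain_def chain_from_def)

lemma chain_from_Nil: "i \<le> r \<Longrightarrow> chain_from \<Phi> \<phi> r i [] \<longleftrightarrow> i = r"
  by (auto simp: chain_from_def monotone_on_def)

text \<open>An exchange argument. Functions up to the jump level can all be moved to
  \<open>v\<close>, the earliest possible place, and no admissible witness can apply a later
  function at \<open>v\<close>. So the greedy choice at the head loses nothing.\<close>

lemma chain_from_Cons:
  assumes "i \<le> r"
  shows "chain_from \<Phi> \<phi> r i (v # q) \<longleftrightarrow> chain_from \<Phi> \<phi> r (jump \<phi> r (\<Phi> v) i) q"
proof -
  define j where "j = jump \<phi> r (\<Phi> v) i"
  have j: "i \<le> j" "j \<le> r" "\<phi> ` {i+1..j} \<subseteq> \<Phi> v"
    unfolding j_def by (fact jump_bounds[OF assms])+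
  have "chain_from \<Phi> \<phi> r j q" if "chain_from \<Phi> \<phi> r i (v # q)"
  proof -
    from that obtain a where mono: "mono_on {i+1..r} a"
      and a: "\<And>m. m \<in> {i+1..r} \<Longrightarrow> a m < length (v # q) \<and> \<phi> m \<in> \<Phi> ((v # q) ! a m)"
      unfolding chain_from_def by blast
    \<comment> \<open>If \<phi>(m) were applied at position 0, monotonicity would put all of
      \<phi>(i+1), ..., \<phi>(m) there, against the maximality of \<open>j\<close>.\<close>
    have pos: "a m > 0" if m: "m \<in> {j+1..r}" for m
    proof (rule ccontr)
      assume "\<not> a m > 0"
      have "\<phi> k \<in> \<Phi> v" if "k \<in> {i+1..m}" for k
      proof -
        have "a k \<le> a m" using monotone_onD[OF mono, of k m] that m j by auto
        with \<open>\<not> a m > 0\<close> a[of k] that m j show ?thesis by auto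
      qed
      then have "m \<le> j" unfolding j_def using m j by (intro jump_greatest) auto
      with m show False by simp
    qed
    \<comment> \<open>Dropping the head shifts positions down by one; by \<open>pos\<close> the
      natural subtraction never truncates.\<close>
    have "mono_on {j+1..r} (\<lambda>m. a m - 1)"
      using mono j by (auto simp: monotone_on_def intro!: diff_le_mono)
    moreover have "a m - 1 < length q \<and> \<phi> m \<in> \<Phi> (q ! (a m - 1))" if "m \<in> {j+1..r}" for m
      using a[of m] pos[OF that] that j by (cases "a m") auto
    ultimately show ?thesis unfolding chain_from_def by blast
  qed
  moreover have "chain_from \<Phi> \<phi> r i (v # q)" if "chain_from \<Phi> \<phi> r j q"
  proof -
    from that obtain a where mono: "mono_on {j+1..r} a"
      and a: "\<And>m. m \<in> {j+1..r} \<Longrightarrow> a m < length q \<and> \<phi> m \<in> \<Phi> (q ! a m)"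
      unfolding chain_from_def by blast
    \<comment> \<open>Functions up to level \<open>j\<close> are applied at the new head, the others
      keep their place one position further on.\<close>
    define b where "b = (\<lambda>m. if m \<le> j then 0 else Suc (a m))"
    have "mono_on {i+1..r} b"
      using mono by (auto simp: monotone_on_def b_def)
    moreover have "b m < length (v # q) \<and> \<phi> m \<in> \<Phi> ((v # q) ! b m)" if "m \<in> {i+1..r}" for m
      using a[of m] that j by (auto simp: b_def)
    ultimately show ?thesis unfolding chain_from_def by blast
  qed
  ultimately show ?thesis unfolding j_def by blast
qed

lemma chain_from_iff_greedy_level:
  "i \<le> r \<Longrightarrow> chain_from \<Phi> \<phi> r i q \<longleftrightarrow> greedy_level \<Phi> \<phi> r i q = r"
  by (induction q arbitrary: i)
    (simp_all add: chain_from_Nil chain_from_Cons jump_bounds(2) greedy_level_def)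

text \<open>Here \<open>i\<close> is the level before the first vertex of the list is entered, so
  the jump is taken at that vertex too. Hence a lift from level 0 starts at level
  \<open>t\<close>.\<close>

fun lift_walk :: "('v \<Rightarrow> 'f set) \<Rightarrow> (nat \<Rightarrow> 'f) \<Rightarrow> nat \<Rightarrow> nat \<Rightarrow> 'v list \<Rightarrow> ('v \<times> nat) list" where
  "lift_walk \<Phi> \<phi> r i [] = []"
| "lift_walk \<Phi> \<phi> r i (v # q) =
    (v, jump \<phi> r (\<Phi> v) i) # lift_walk \<Phi> \<phi> r (jump \<phi> r (\<Phi> v) i) q"

lemma map_fst_lift_walk [simp]: "map fst (lift_walk \<Phi> \<phi> r i q) = q"
  by (induction q arbitrary: i) auto

lemma lift_walk_eq_Nil_iff [simp]: "lift_walk \<Phi> \<phi> r i q = [] \<longleftrightarrow> q = []"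
  by (cases q) auto

lemma hd_lift_walk: "q \<noteq> [] \<Longrightarrow> hd (lift_walk \<Phi> \<phi> r i q) = (hd q, jump \<phi> r (\<Phi> (hd q)) i)"
  by (cases q) auto

lemma last_lift_walk:
  "q \<noteq> [] \<Longrightarrow> last (lift_walk \<Phi> \<phi> r i q) = (last q, greedy_level \<Phi> \<phi> r i q)"
  by (induction q arbitrary: i) (auto simp: greedy_level_def)

lemma vwalk_cost_virtual: "vwalk_cost (virtual_cost c) p = vwalk_cost c (map fst p)"
  by (induction p rule: vwalk_arcs.induct) (auto simp: vwalk_cost_def virtual_cost_def)

lemma vwalk_Cons_Cons_iff:
  "vwalk (u # v # q) G \<longleftrightarrow> u \<in> verts G \<and> (u, v) \<in> arcs_ends G \<and> vwalk (v # q) G"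
  by (auto simp: vwalk_def)

lemma vwalk_lift_walk:
  assumes "vwalk q (with_proj G)" and "i \<le> r"
  shows "vwalk (lift_walk \<Phi> \<phi> r i q) (with_proj (virtual_graph G \<Phi> \<phi> r))"
  using assms
proof (induction q arbitrary: i rule: vwalk_arcs.induct)
  case (3 u v q)
  define j where "j = jump \<phi> r (\<Phi> u) i"
  have "j \<le> r" unfolding j_def using 3 by (intro jump_bounds)
  with 3 show ?case
    by (auto simp: vwalk_Cons_Cons_iff virtual_graph_def simp flip: j_def)
qed (auto simp: vwalk_def virtual_graph_def jump_bounds(2))

text \<open>The head of a virtual arc has its level forced by the level of the tail and the vertex
  entered, so the initial level and the projection determine the whole walk.\<close>

lemma vwalk_virtual_graph_lift:
  assumes "vwalk ((u, i) # p) (with_proj (virtual_graph G \<Phi> \<phi> r))"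
  shows "lift_walk \<Phi> \<phi> r i (map fst p) = p"
  using assms
  by (induction p arbitrary: u i) (auto simp: vwalk_Cons_Cons_iff virtual_graph_def)

lemma vwalk_map_fst:
  assumes "vwalk p (with_proj (virtual_graph G \<Phi> \<phi> r))"
  shows "vwalk (map fst p) (with_proj G)"
  using assms
  by (induction p rule: vwalk_arcs.induct)
    (auto simp: vwalk_Cons_Cons_iff virtual_graph_def)

lemma walks_between_virtual_graph:
  assumes "t = jump \<phi> r (\<Phi> s) 0"
  shows "walks_between (with_proj (virtual_graph G \<Phi> \<phi> r)) (s, t) (d, r) =
    lift_walk \<Phi> \<phi> r 0 ` sfc_walks (with_proj G) \<Phi> \<phi> r s d" (is "?W = ?L ` ?S")
proof (intro equalityI subsetI)
  fix p assume p: "p \<in> ?W"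
  then obtain p' where p': "p = (s, t) # p'"
    by (cases p) (auto simp: walks_between_def vwalk_def)
  have walk: "vwalk p (with_proj (virtual_graph G \<Phi> \<phi> r))" and last: "last p = (d, r)"
    using p by (auto simp: walks_between_def)
  \<comment> \<open>The tail \<open>p'\<close> is the lift of its projection from level
    \<open>t\<close>; since \<open>t\<close> is the jump at \<open>s\<close> from level 0, the first
    vertex fits as well.\<close>
  then have eq: "?L (map fst p) = p"
    using vwalk_virtual_graph_lift[of s t p'] assms by (simp add: p')
  have "last (?L (map fst p)) = (last (map fst p), greedy_level \<Phi> \<phi> r 0 (map fst p))"
    by (rule last_lift_walk) (simp add: p')
  with eq last have "last (map fst p) = d" "greedy_level \<Phi> \<phi> r 0 (map fst p) = r"
    by auto
  moreover have "hd (map fst p) = s"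
    by (simp add: p')
  ultimately have "map fst p \<in> ?S"
    using vwalk_map_fst[OF walk]
    by (simp add: sfc_walks_def walks_between_def satisfies_chain_iff_chain_from
        chain_from_iff_greedy_level)
  with eq[symmetric] show "p \<in> ?L ` ?S" by blast
next
  fix p assume "p \<in> ?L ` ?S"
  then obtain q where q: "q \<in> ?S" "p = ?L q" by blast
  then have "q \<noteq> []" by (auto simp: sfc_walks_def walks_between_def vwalk_def)
  with q assms show "p \<in> ?W"
    by (auto simp: sfc_walks_def walks_between_def satisfies_chain_iff_chain_from
        chain_from_iff_greedy_level hd_lift_walk last_lift_walk vwalk_lift_walk)
qed

text \<open>Any occurrence of \<open>x\<close> is interior, so its neighbours on the walk supply the
  arcs. Consequently a vertex that may be pruned lies on no walk from source to destination.\<close>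

lemma vwalk_interior_arcs:
  assumes "vwalk p H" "x \<in> set p" "x \<noteq> hd p" "x \<noteq> last p"
  shows "in_arcs H x \<noteq> {}" "out_arcs H x \<noteq> {}"
proof -
  obtain xs ys where p: "p = xs @ x # ys" using assms(2) by (auto simp: in_set_conv_decomp)
  with assms have "xs \<noteq> []" "ys \<noteq> []" by auto
  with p have "(last xs, x) \<in> set (vwalk_arcs p)" "(x, hd ys) \<in> set (vwalk_arcs p)"
    by (simp_all add: vwalk_arcs_append)
  with assms(1) have "(last xs, x) \<in> arcs_ends H" "(x, hd ys) \<in> arcs_ends H"
    by (auto simp: vwalk_def)
  then show "in_arcs H x \<noteq> {}" "out_arcs H x \<noteq> {}"
    by (auto simp: arcs_ends_conv in_arcs_def out_arcs_def)
qed

lemma vwalk_del_vert_iff: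
  "vwalk p (pre_digraph.del_vert H x) \<longleftrightarrow> vwalk p H \<and> x \<notin> set p"
  by (induction p rule: vwalk_arcs.induct)
    (auto simp: vwalk_Cons_Cons_iff pre_digraph.del_vert_simps arcs_ends_conv)

lemma walks_between_prune_step:
  assumes "prune_step s d H H'"
  shows "walks_between H' s d = walks_between H s d"
  using assms
proof cases
  case (1 x)
  then have "x \<notin> set p" if "p \<in> walks_between H s d" for p
    using vwalk_interior_arcs[of p H x] that by (auto simp: walks_between_def)
  with 1 show ?thesis by (auto simp: walks_between_def vwalk_del_vert_iff)
qed

lemma walks_between_pruned:
  assumes "pruned s d H H'"
  shows "walks_between H' s d = walks_between H s d"
proof -
  have "(prune_step s d)\<^sup>*\<^sup>* H H'" using assms by (simp add: pruned_def)
  then show ?thesis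
    by induction (auto dest: walks_between_prune_step)
qed

theorem theorem1:
  fixes G :: "'v pair_pre_digraph"
    and c :: "'v \<times> 'v \<Rightarrow> real"
    and \<Phi> :: "'v \<Rightarrow> 'f set"
    and \<phi> :: "nat \<Rightarrow> 'f"
    and r t :: nat
    and v\<^sub>s v\<^sub>d :: 'v
    and H :: "('v \<times> nat, ('v \<times> nat) \<times> ('v \<times> nat)) pre_digraph"
    and p' :: "('v \<times> nat) list"
  assumes "pair_fin_digraph G"
    and "v\<^sub>s \<in> pverts G" and "v\<^sub>d \<in> pverts G"
    and "t = Max {j. j \<le> r \<and> \<phi> ` {1..j} \<subseteq> \<Phi> v\<^sub>s}"
    and "H = with_proj (virtual_graph G \<Phi> \<phi> r) \<or>
         pruned (v\<^sub>s, t) (v\<^sub>d, r) (with_proj (virtual_graph G \<Phi> \<phi> r)) H"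
    and "shortest_in (virtual_cost c) (walks_between H (v\<^sub>s, t) (v\<^sub>d, r)) p'"
  shows "shortest_in c (sfc_walks (with_proj G) \<Phi> \<phi> r v\<^sub>s v\<^sub>d) (map fst p')"
proof -
  let ?V = "with_proj (virtual_graph G \<Phi> \<phi> r)"
  have "t = jump \<phi> r (\<Phi> v\<^sub>s) 0" using assms(4) by (simp add: jump_def)
  then have "walks_between ?V (v\<^sub>s, t) (v\<^sub>d, r) =
      lift_walk \<Phi> \<phi> r 0 ` sfc_walks (with_proj G) \<Phi> \<phi> r v\<^sub>s v\<^sub>d"
    by (rule walks_between_virtual_graph)
  moreover have "walks_between H (v\<^sub>s, t) (v\<^sub>d, r) = walks_between ?V (v\<^sub>s, t) (v\<^sub>d, r)"
    using assms(5) by (elim disjE) (simp, rule walks_between_pruned)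
  \<comment> \<open>A competitor in G is compared with \<open>p'\<close> through its lift, which has
    the same cost because \<open>map fst\<close> recovers the competitor.\<close>
  ultimately show ?thesis
    using assms(6) by (auto simp: shortest_in_def vwalk_cost_virtual)
qed

end
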